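(* Let $c_1,c_2,c_3\in\mathbb R$. The sextic $\Phi[c_1,c_2,c_3,1]$ is psd if and only if $(1+c_1,1+c_3)\in K$ and $|c_2|\le\sigma(c_1,c_3)$, where $\sigma(c_1,c_3)\ge 0$ is the function, defined for all $(c_1,c_3)$ with $(1+c_1,1+c_3)\in K$, given by $$\sigma(c_1,c_3)=\min_{u>0}\ \tfrac12\left((1+c_1)u^{-3}-u^{-1}-u+(1+c_3)u^3\right).$$ Moreover, if $(1+c_1,1+c_3)\in K$ and $c_2=\pm\sigma(c_1,c_3)$, then $\Phi[c_1,c_2,c_3,1]=R_t+\mu\,(t^3F_1\pm F_2)^2$ for suitable $t>0$, $\mu\in\mathbb R$ and choice of sign.
   Context: A form is psd if it is nonnegative on all real points. Let $$F_1=x^3-xz^2,\qquad F_2=y^3-yz^2,$$ $$R=x^6+y^6+z^6-x^4y^2-x^2y^4-x^4z^2-y^4z^2-x^2z^4-y^2z^4+3x^2y^2z^2,$$ $$\Phi[c_1,c_2,c_3,c_4](x,y,z)=c_1F_1^2+2c_2F_1F_2+c_3F_2^2+c_4R.$$ For $t>0$ let $\alpha(t)=\frac{2t^2+t^4}{3}$ and $\beta(t)=\frac{1+2t^2}{3t^4}$; $\alpha$ is an increasing bijection of $(0,\infty)$ onto itself, and $\gamma(x)=\beta(\alpha^{-1}(x))$ for $x>0$. Let $K=\{(x,y)\in\mathbb R^2: x>0,\ y\ge\gamma(x)\}$. For $t>0$ let $$R_t=\Phi[\alpha(t)-1,0,\beta(t)-1,1]=\Big(\tfrac{t^4+2t^2-3}{3}\Big)F_1^2+\Big(\tfrac{1+2t^2-3t^4}{3t^4}\Big)F_2^2+R.$$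 *)

theory Defs
  imports Complex_Main
begin

text \<open>Ternary real forms are represented by their polynomial functions; since \<^typ>\<open>real\<close> is
  infinite, equality of the functions is equality of the forms.\<close>

type_synonym form3 = "real \<Rightarrow> real \<Rightarrow> real \<Rightarrow> real"

definition psd :: "form3 \<Rightarrow> bool" where
  "psd p \<longleftrightarrow> (\<forall>x y z. 0 \<le> p x y z)"

definition F1 :: form3 where
  "F1 x y z = x^3 - x * z^2"

definition F2 :: form3 where
  "F2 x y z = y^3 - y * z^2"

definition R :: form3 where
  "R x y z = x^6 + y^6 + z^6 - x^4 * y^2 - x^2 * y^4 - x^4 * z^2 - y^4 * z^2
     - x^2 * z^4 - y^2 * z^4 + 3 * x^2 * y^2 * z^2"

definition Phi :: "real \<Rightarrow> real \<Rightarrow> real \<Rightarrow> real \<Rightarrow> form3" where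
  "Phi c1 c2 c3 c4 x y z =
     c1 * (F1 x y z)^2 + 2 * c2 * F1 x y z * F2 x y z + c3 * (F2 x y z)^2 + c4 * R x y z"

definition alpha :: "real \<Rightarrow> real" where
  "alpha t = (2 * t^2 + t^4) / 3"

definition beta :: "real \<Rightarrow> real" where
  "beta t = (1 + 2 * t^2) / (3 * t^4)"

text \<open>The inverse is that of \<^const>\<open>alpha\<close> restricted to the positive reals.\<close>

definition gamma :: "real \<Rightarrow> real" where
  "gamma x = beta (the_inv_into {0<..} alpha x)"

definition K :: "(real \<times> real) set" where
  "K = {(x, y). 0 < x \<and> gamma x \<le> y}"

definition Rt :: "real \<Rightarrow> form3" where
  "Rt t = Phi (alpha t - 1) 0 (beta t - 1) 1"

definition sigma_obj :: "real \<Rightarrow> real \<Rightarrow> real \<Rightarrow> real" where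
  "sigma_obj c1 c3 u =
     1/2 * ((1 + c1) * u powi (-3) - u powi (-1) - u + (1 + c3) * u^3)"

text \<open>\<^const>\<open>Least\<close> is the minimum of a set of values. It is unspecified where the minimum
  does not exist, so attainment has to be stated separately.\<close>

definition sigma :: "real \<Rightarrow> real \<Rightarrow> real" where
  "sigma c1 c3 = (LEAST m. \<exists>u>0. m = sigma_obj c1 c3 u)"

end

theory Submission imports Defs "HOL-Real_Asymp.Real_Asymp" begin

text \<open>Restricting to \<open>z = 0\<close> and dividing by \<open>x\<^sup>3 y\<^sup>3\<close> turns psd-ness into
  \<open>\<bar>c\<^sub>2\<bar> \<le> sigma_obj c\<^sub>1 c\<^sub>3 u\<close> for all \<open>u > 0\<close>, and \<^const>\<open>K\<close> is exactly the region in which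
  the right-hand side is nonnegative. Conversely, at a minimizer \<open>t\<close> of the objective with minimum
  \<open>m\<close>, the vanishing derivative gives \<open>1 + c\<^sub>1 = \<alpha>(t) + \<mu> t\<^sup>6\<close>, \<open>1 + c\<^sub>3 = \<beta>(t) + \<mu>\<close>
  with \<open>\<mu> = m / t\<^sup>3 \<ge> 0\<close>, so the extreme cases \<open>c\<^sub>2 = \<plusminus>m\<close> are \<open>R\<^sub>t\<close> plus a square, and the
  intermediate ones follow because \<open>\<Phi>\<close> is affine in \<open>c\<^sub>2\<close>. That \<open>R\<^sub>t\<close> is psd is a
  Schur-like inequality: with \<open>X = x\<^sup>2\<close>, \<open>Y = y\<^sup>2\<close>, \<open>Z = z\<^sup>2\<close>, it equals
  \<open>\<alpha> X (X - Z)\<^sup>2 - (X + Y - Z) (X - Z) (Y - Z) + \<beta> Y (Y - Z)\<^sup>2\<close>.\<close>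

section \<open>The bijection \<open>alpha\<close> of the positive reals\<close>

lemma alpha_pos: "t > 0 \<Longrightarrow> alpha t > 0"
  by (simp add: alpha_def add_pos_pos)

lemma beta_pos: "t > 0 \<Longrightarrow> beta t > 0"
  by (simp add: beta_def add_pos_pos)

lemma inj_on_alpha: "inj_on alpha {0<..}"
proof (rule strict_mono_on_imp_inj_on, rule strict_mono_onI)
  fix s t :: real
  assume "s \<in> {0<..}" "s < t"
  then have "s^2 < t^2" "s^4 < t^4"
    by (auto intro: power_strict_mono)
  then show "alpha s < alpha t"
    by (simp add: alpha_def)
qed

lemma alpha_surj:
  assumes "a > 0"
  obtains t where "t > 0" "alpha t = a"
proof
  \<comment> \<open>\<open>r\<close> stands for \<open>t^2 + 1\<close>: the equation
    \<open>alpha t = a\<close> reads \<open>(t^2 + 1)^2 = 1 + 3 * a\<close>.\<close>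
  define r where "r = sqrt (1 + 3 * a)"
  have r: "r > 1" "r^2 = 1 + 3 * a"
    using assms by (auto simp: r_def)
  then show "sqrt (r - 1) > 0"
    by simp
  have 2: "(sqrt (r - 1))^2 = r - 1"
    using r by simp
  have "(sqrt (r - 1))^4 = ((sqrt (r - 1))^2)^2"
    by simp
  then have 4: "(sqrt (r - 1))^4 = (r - 1)^2"
    by (simp only: 2)
  show "alpha (sqrt (r - 1)) = a"
    unfolding alpha_def 2 4 using r(2) by (simp add: power2_eq_square algebra_simps)
qed

lemma gamma_alpha: "t > 0 \<Longrightarrow> gamma (alpha t) = beta t"
  by (simp add: gamma_def the_inv_into_f_f[OF inj_on_alpha])

section \<open>Nonnegativity of the forms \<open>Rt t\<close>\<close>

lemma alpha_beta_cubic_nonneg: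
  assumes "t > 0" "p \<ge> 0" "q \<ge> 0"
  shows "alpha t * p^3 - p^2 * q - p * q^2 + beta t * q^3 \<ge> 0"
proof -
  \<comment> \<open>\<open>alpha t\<close> and \<open>beta t\<close> are the coefficients that give
    the cubic a double root at \<open>q = t^2 * p\<close>.\<close>
  have "3 * t^4 * (alpha t * p^3 - p^2 * q - p * q^2 + beta t * q^3) =
      (q - t^2 * p)^2 * ((1 + 2 * t^2) * q + (2 * t^2 + t^4) * p)"
    using assms(1) by (simp add: alpha_def beta_def field_simps) algebra
  also have "\<dots> \<ge> 0"
    using assms by simp
  finally show ?thesis
    using assms(1) by (simp add: zero_le_mult_iff)
qed

lemma alpha_beta_quadratic_nonneg:
  assumes "t > 0"
  shows "alpha t * p^2 - p * q + beta t * q^2 \<ge> 0"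
proof -
  have "12 * t^4 * (alpha t * p^2 - p * q + beta t * q^2) =
      4 * (t^4 * p)^2 + 8 * t^2 * (t^2 * p)^2 - 12 * t^4 * p * q + 4 * q^2 + 8 * t^2 * q^2"
    using assms by (simp add: alpha_def beta_def field_simps)
  \<comment> \<open>The cross term \<open>12 * t^4 * p * q\<close> is split as 4 + 8 to complete one
    square with each of the two \<open>p^2\<close> terms.\<close>
  also have "\<dots> = (2 * t^4 * p - q)^2 + 8 * t^2 * (t^2 * p - q / 2)^2 + 3 * q^2 + 6 * t^2 * q^2"
    by (simp add: power2_eq_square power4_eq_xxxx field_simps)
  also have "\<dots> \<ge> 0"
    by simp
  finally show ?thesis
    using assms by (simp add: zero_le_mult_iff)
qed

text \<open>As in Schur's inequality, the position of \<open>Z\<close> relative to \<open>X\<close>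
  and \<open>Y\<close> decides. When \<open>X\<close> and \<open>Y\<close> lie on the same side of
  \<open>Z\<close>, the least of the three variables is split off as a factor of the quadratic form
  in \<open>X - Z\<close> and \<open>Y - Z\<close>, and the rest is nonnegative.\<close>

lemma schur_like:
  fixes a b X Y Z :: real
  assumes "a \<ge> 0" "b \<ge> 0" "X \<ge> 0" "Y \<ge> 0" "Z \<ge> 0"
    and quadratic: "\<And>p q. a * p^2 - p * q + b * q^2 \<ge> 0"
    and cubic: "\<And>p q. p \<ge> 0 \<Longrightarrow> q \<ge> 0 \<Longrightarrow> a * p^3 - p^2 * q - p * q^2 + b * q^3 \<ge> 0"
  shows "a * X * (X - Z)^2 - (X + Y - Z) * (X - Z) * (Y - Z) + b * Y * (Y - Z)^2 \<ge> 0"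
proof -
  \<comment> \<open>If \<open>Z\<close> lies between \<open>X\<close> and \<open>Y\<close>, the
    larger of them is at least \<open>Z\<close> and the other is nonnegative, so
    \<open>X + Y - Z \<ge> 0\<close>.\<close>
  consider "X \<ge> Z" "Y \<ge> Z" | "(X - Z) * (Y - Z) \<le> 0" "X + Y - Z \<ge> 0"
    | "X \<le> Z" "Y \<le> X" | "Y \<le> Z" "X \<le> Y"
    using assms by (smt (verit) mult_nonneg_nonpos mult_nonpos_nonneg)
  then show ?thesis
  proof cases
    case 1
    have "a * X * (X - Z)^2 - (X + Y - Z) * (X - Z) * (Y - Z) + b * Y * (Y - Z)^2 =
        Z * (a * (X - Z)^2 - (X - Z) * (Y - Z) + b * (Y - Z)^2) +
        (a * (X - Z)^3 - (X - Z)^2 * (Y - Z) - (X - Z) * (Y - Z)^2 + b * (Y - Z)^3)"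
      by algebra
    also have "\<dots> \<ge> 0"
      using 1 assms(5) quadratic cubic by (intro add_nonneg_nonneg[OF mult_nonneg_nonneg]) simp_all
    finally show ?thesis .
  next
    case 2
    then have "(X + Y - Z) * ((X - Z) * (Y - Z)) \<le> 0"
      by (rule mult_nonneg_nonpos[rotated])
    moreover have "a * X * (X - Z)^2 \<ge> 0" "b * Y * (Y - Z)^2 \<ge> 0"
      using assms by simp_all
    ultimately show ?thesis
      by (simp add: mult.assoc)
  next
    case 3
    have "a * X * (X - Z)^2 - (X + Y - Z) * (X - Z) * (Y - Z) + b * Y * (Y - Z)^2 =
        Y * (a * (X - Z)^2 - (X - Z) * (Y - Z) + b * (Y - Z)^2) +
        (a * (X - Y) * (X - Z)^2 + (Z - X)^2 * (Z - Y))"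
      by algebra
    also have "\<dots> \<ge> 0"
      using 3 assms(1,4) by (intro add_nonneg_nonneg mult_nonneg_nonneg quadratic) simp_all
    finally show ?thesis .
  next
    case 4
    have "a * X * (X - Z)^2 - (X + Y - Z) * (X - Z) * (Y - Z) + b * Y * (Y - Z)^2 =
        X * (a * (X - Z)^2 - (X - Z) * (Y - Z) + b * (Y - Z)^2) +
        (b * (Y - X) * (Y - Z)^2 + (Z - X) * (Z - Y)^2)"
      by algebra
    also have "\<dots> \<ge> 0"
      using 4 assms(2,3) by (intro add_nonneg_nonneg mult_nonneg_nonneg quadratic) simp_all
    finally show ?thesis .
  qed
qed

lemma psd_Rt:
  assumes "t > 0"
  shows "psd (Rt t)"
  unfolding psd_def
proof (intro allI)
  fix x y z
  have "Rt t x y z = alpha t * x^2 * (x^2 - z^2)^2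
      - (x^2 + y^2 - z^2) * (x^2 - z^2) * (y^2 - z^2) + beta t * y^2 * (y^2 - z^2)^2"
    unfolding Rt_def Phi_def F1_def F2_def R_def by algebra
  also have "\<dots> \<ge> 0"
    using assms alpha_pos beta_pos alpha_beta_quadratic_nonneg alpha_beta_cubic_nonneg
    by (intro schur_like) (auto intro: less_imp_le)
  finally show "Rt t x y z \<ge> 0" .
qed

section \<open>The objective and the region \<open>K\<close>\<close>

lemma sigma_obj_eq:
  assumes "u > 0"
  shows "sigma_obj c1 c3 u = ((1 + c1) - u^2 - u^4 + (1 + c3) * u^6) / (2 * u^3)"
  using assms
  by (simp add: sigma_obj_def power_int_minus field_simps power2_eq_square power3_eq_cube
      power4_eq_xxxx power_numeral_reduce)

text \<open>Clears the denominator \<open>2 * u^3\<close>; the polynomial obtained is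
  \<open>Phi c1 (- m) c3 1 1 u 0\<close>.\<close>

lemma le_sigma_obj_iff:
  assumes "u > 0"
  shows "m \<le> sigma_obj c1 c3 u \<longleftrightarrow> 0 \<le> (1 + c1) - u^2 - u^4 + (1 + c3) * u^6 - 2 * m * u^3"
  using assms by (simp add: sigma_obj_eq field_simps)

text \<open>For \<open>1 + c1 = alpha t\<close>, the value \<open>1 + c3 = beta t\<close> is the
  smallest that keeps the objective nonnegative: it then has a double zero at \<open>u = t\<close>.
  So the cubic inequality gives one direction and evaluation at \<open>t\<close> the other.\<close>

lemma mem_K_iff:
  "(1 + c1, 1 + c3) \<in> K \<longleftrightarrow> (\<forall>u>0. 0 \<le> sigma_obj c1 c3 u)"
proof (intro iffI allI impI)
  fix u :: real
  assume K: "(1 + c1, 1 + c3) \<in> K" and u: "u > 0"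
  then obtain t where t: "t > 0" "alpha t = 1 + c1"
    by (auto simp: K_def elim: alpha_surj[of "1 + c1"])
  then have "beta t \<le> 1 + c3"
    using K gamma_alpha[of t] by (simp add: K_def)
  then have "beta t * u^6 \<le> (1 + c3) * u^6"
    by (intro mult_right_mono) auto
  moreover have "0 \<le> (1 + c1) - u^2 - u^4 + beta t * u^6"
    using alpha_beta_cubic_nonneg[OF t(1), of 1 "u^2"] by (simp add: t(2) flip: power_mult)
  ultimately show "0 \<le> sigma_obj c1 c3 u"
    unfolding le_sigma_obj_iff[OF u] by linarith
next
  assume nonneg: "\<forall>u>0. 0 \<le> sigma_obj c1 c3 u"
  have pos: "1 + c1 > 0"
  proof (rule ccontr)
    assume "\<not> 1 + c1 > 0"
    \<comment> \<open>\<open>v\<close> plays the role of \<open>u^2\<close>, small enough that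
      \<open>(1 + c3) * v^3 \<le> v^2\<close>. What remains is \<open>v \<le> 1 + c1\<close>,
      contradicting \<open>v > 0\<close>.\<close>
    define v where "v = 1 / (1 + \<bar>1 + c3\<bar>)"
    have v: "0 < v" "v \<le> 1" "(1 + c3) * v \<le> 1"
      by (auto simp: v_def field_simps)
    have "0 \<le> (1 + c1) - (sqrt v)^2 - (sqrt v)^4 + (1 + c3) * (sqrt v)^6"
      using nonneg v(1) le_sigma_obj_iff[of "sqrt v" 0 c1 c3] by simp
    moreover have "(sqrt v)^4 = ((sqrt v)^2)^2" "(sqrt v)^6 = ((sqrt v)^2)^3"
      by (simp_all flip: power_mult)
    ultimately have "0 \<le> (1 + c1) - v - v^2 + (1 + c3) * v^3"
      using v(1) by simp
    moreover have "(1 + c3) * v * v^2 \<le> 1 * v^2"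
      using v(3) by (rule mult_right_mono) simp
    ultimately show False
      using v(1) \<open>\<not> 1 + c1 > 0\<close> by (simp add: power3_eq_cube power2_eq_square algebra_simps)
  qed
  then obtain t where t: "t > 0" "alpha t = 1 + c1"
    by (rule alpha_surj)
  have "0 \<le> alpha t - t^2 - t^4 + (1 + c3) * t^6"
    using nonneg t le_sigma_obj_iff[of t 0 c1 c3] by simp
  also have "\<dots> = ((1 + c3) - beta t) * t^6"
    using t(1) by (simp add: alpha_def beta_def field_simps)
  finally have "beta t \<le> 1 + c3"
    using t(1) by (simp add: zero_le_mult_iff)
  then show "(1 + c1, 1 + c3) \<in> K"
    using pos gamma_alpha[OF t(1)] t(2) by (simp add: K_def)
qed

lemma K_pos:
  assumes "(a, b) \<in> K"
  shows "a > 0" "b > 0"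
proof -
  show "a > 0"
    using assms by (simp add: K_def)
  then obtain t where "t > 0" "alpha t = a"
    by (rule alpha_surj)
  then show "b > 0"
    using assms gamma_alpha[of t] beta_pos[of t] by (simp add: K_def)
qed

section \<open>Minimizers and the decomposition they yield\<close>

lemma sigma_obj_attains_min:
  assumes "1 + c1 > 0" "1 + c3 > 0"
  obtains t where "t > 0" "\<And>u. u > 0 \<Longrightarrow> sigma_obj c1 c3 t \<le> sigma_obj c1 c3 u"
proof -
  define a b where "a = 1 + c1" and "b = 1 + c3"
  define f where "f u = (a - u^2 - u^4 + b * u^6) / (2 * u^3)" for u :: real
  have f: "sigma_obj c1 c3 u = f u" if "u > 0" for u
    using that by (simp add: sigma_obj_eq f_def a_def b_def)
  have ab: "a > 0" "b > 0"
    using assms by (simp_all add: a_def b_def)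
  \<comment> \<open>The objective blows up at both ends of the half-line, so a minimum over a
    compact interval containing 1, outside which \<open>f\<close> is at least \<open>f 1\<close>, is
    global.\<close>
  have "filterlim f at_top (at_right 0)" "filterlim f at_top at_top"
    unfolding f_def using ab by real_asymp+
  then have "\<forall>\<^sub>F u in at_right 0. f 1 \<le> f u" "\<forall>\<^sub>F u in at_top. f 1 \<le> f u"
    by (simp_all add: filterlim_at_top)
  then obtain d L where d: "d > 0" "\<And>u. 0 < u \<Longrightarrow> u < d \<Longrightarrow> f 1 \<le> f u"
    and L: "\<And>u. L \<le> u \<Longrightarrow> f 1 \<le> f u"
    unfolding eventually_at_right_field eventually_at_top_linorder by auto
  define I where "I = {min d 1..max L 1}"
  have "continuous_on I f"
    unfolding f_def I_def using d(1) by (intro continuous_intros) auto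
  moreover have "compact I" "1 \<in> I"
    by (simp_all add: I_def)
  ultimately obtain t where t: "t \<in> I" "\<And>u. u \<in> I \<Longrightarrow> f t \<le> f u"
    using continuous_attains_inf[of I f] by blast
  show ?thesis
  proof
    show "t > 0"
      using t(1) d(1) by (auto simp: I_def)
    fix u :: real
    assume u: "u > 0"
    have "f t \<le> f u"
    proof (cases "u \<in> I")
      case False
      then have "f 1 \<le> f u"
        using u d(2)[of u] L[of u] by (auto simp: I_def)
      then show ?thesis
        using t(2)[OF \<open>1 \<in> I\<close>] by simp
    qed (simp add: t(2))
    then show "sigma_obj c1 c3 t \<le> sigma_obj c1 c3 u"
      using u \<open>t > 0\<close> by (simp add: f)
  qed
qed

lemma sigma_eqI:
  assumes "t > 0" "\<And>u. u > 0 \<Longrightarrow> sigma_obj c1 c3 t \<le> sigma_obj c1 c3 u"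
  shows "sigma c1 c3 = sigma_obj c1 c3 t"
  unfolding sigma_def using assms by (intro Least_equality) auto

lemma decomposition_at_min:
  assumes t: "t > 0" and min: "\<And>u. u > 0 \<Longrightarrow> sigma_obj c1 c3 t \<le> sigma_obj c1 c3 u"
    and s: "s^2 = 1"
  defines "m \<equiv> sigma_obj c1 c3 t"
  shows "Phi c1 (s * m) c3 1 =
    (\<lambda>x y z. Rt t x y z + m / t^3 * (t^3 * F1 x y z + s * F2 x y z)^2)"
proof -
  \<comment> \<open>\<open>g u\<close> is \<open>2 * u^3\<close> times the excess of the objective
    over its minimum, so it is nonnegative for \<open>u > 0\<close> and vanishes at
    \<open>t\<close>. The two equations \<open>g t = 0\<close> and \<open>g' t = 0\<close> are
    linear in \<open>c1\<close> and \<open>c3\<close> and determine them from \<open>t\<close> and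
    \<open>m\<close>.\<close>
  define g where "g u = (1 + c1) - u^2 - u^4 + (1 + c3) * u^6 - 2 * m * u^3" for u
  have gt: "g t = 0"
    using t by (simp add: g_def m_def sigma_obj_eq)
  have g_nonneg: "g u \<ge> 0" if "u > 0" for u
    using min[OF that] le_sigma_obj_iff[OF that, of m] by (simp add: m_def g_def)
  have "(g has_real_derivative (- 2 * t - 4 * t^3 + 6 * (1 + c3) * t^5 - 6 * m * t^2)) (at t)"
    unfolding g_def by (auto intro!: derivative_eq_intros simp: algebra_simps)
  then have "- 2 * t - 4 * t^3 + 6 * (1 + c3) * t^5 - 6 * m * t^2 = 0"
    by (rule DERIV_local_min[of _ _ _ t]) (use t gt g_nonneg in \<open>auto simp: abs_less_iff\<close>)
  then have "2 * t * (3 * t^4 * (1 + c3) - (1 + 2 * t^2 + 3 * m * t)) = 0"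
    by algebra
  then have crit: "3 * t^4 * (1 + c3) = 1 + 2 * t^2 + 3 * m * t"
    using t by simp
  obtain \<mu> where \<mu>: "m / t^3 = \<mu>"
    by simp
  then have m: "m = \<mu> * t^3"
    using t by (simp add: field_simps)
  have "1 + c3 = (1 + 2 * t^2 + 3 * m * t) / (3 * t^4)"
    using t crit by (simp add: field_simps)
  also have "\<dots> = beta t + \<mu>"
    using t by (simp add: beta_def m field_simps power4_eq_xxxx power3_eq_cube)
  finally have c3: "c3 = beta t + \<mu> - 1"
    by simp
  \<comment> \<open>The definition of \<open>beta\<close> without division, as
    \<open>algebra\<close> needs it to eliminate \<open>beta t * t^6\<close> from
    \<open>g t = 0\<close>.\<close>
  have "3 * t^2 * beta t * t^4 = t^2 * (1 + 2 * t^2)"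
    using t by (simp add: beta_def)
  then have c1: "c1 = alpha t + \<mu> * t^6 - 1"
    using gt unfolding g_def m c3 alpha_def by algebra
  show ?thesis
    unfolding Rt_def Phi_def \<mu> unfolding m
    by (intro ext) (use s c1 c3 in algebra)
qed

section \<open>The criterion for \<open>Phi\<close> to be psd\<close>

lemma psd_Phi_imp_le_sigma_obj:
  assumes "psd (Phi c1 c2 c3 1)" "u > 0"
  shows "\<bar>c2\<bar> \<le> sigma_obj c1 c3 u"
proof -
  \<comment> \<open>These values are \<open>2 * u^3\<close> times the objective minus
    \<open>c2\<close> and plus \<open>c2\<close>, respectively.\<close>
  have "Phi c1 c2 c3 1 1 (- u) 0 \<ge> 0" "Phi c1 c2 c3 1 1 u 0 \<ge> 0"
    using assms(1) by (simp_all add: psd_def)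
  then have "c2 \<le> sigma_obj c1 c3 u" "- c2 \<le> sigma_obj c1 c3 u"
    using assms(2)
    by (simp_all add: le_sigma_obj_iff Phi_def F1_def F2_def R_def algebra_simps flip: power_mult)
  then show ?thesis
    by simp
qed

lemma psd_Phi_between:
  assumes "psd (Phi c1 m c3 1)" "psd (Phi c1 (- m) c3 1)" "\<bar>c2\<bar> \<le> m"
  shows "psd (Phi c1 c2 c3 1)"
  unfolding psd_def
proof (intro allI)
  fix x y z
  define w where "w = F1 x y z * F2 x y z"
  \<comment> \<open>Whatever the sign of \<open>w\<close>, one of the two endpoint forms has the
    cross term \<open>- 2 * \<bar>m * w\<bar>\<close>, which is at most
    \<open>2 * c2 * w\<close>.\<close>
  have "\<bar>c2 * w\<bar> \<le> \<bar>m * w\<bar>"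
    unfolding abs_mult using assms(3) by (intro mult_right_mono) auto
  moreover have "0 \<le> Phi c1 m c3 1 x y z" "0 \<le> Phi c1 (- m) c3 1 x y z"
    using assms by (simp_all add: psd_def)
  ultimately show "0 \<le> Phi c1 c2 c3 1 x y z"
    unfolding Phi_def by (simp add: w_def mult.assoc)
qed

theorem theorem5p7:
  fixes c1 c2 c3 :: real
  shows
    "(psd (Phi c1 c2 c3 1) \<longleftrightarrow> (1 + c1, 1 + c3) \<in> K \<and> \<bar>c2\<bar> \<le> sigma c1 c3) \<and>
     ((1 + c1, 1 + c3) \<in> K \<longrightarrow>
        0 \<le> sigma c1 c3 \<and>
        (\<exists>u>0. sigma c1 c3 = sigma_obj c1 c3 u) \<and>
        (\<forall>u>0. sigma c1 c3 \<le> sigma_obj c1 c3 u)) \<and>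
     ((1 + c1, 1 + c3) \<in> K \<and> (c2 = sigma c1 c3 \<or> c2 = - sigma c1 c3) \<longrightarrow>
        (\<exists>t>0. \<exists>\<mu>. \<exists>s\<in>{1, -1}.
           Phi c1 c2 c3 1 = (\<lambda>x y z. Rt t x y z + \<mu> * (t^3 * F1 x y z + s * F2 x y z)^2)))"
proof (cases "(1 + c1, 1 + c3) \<in> K")
  case False
  then have "\<not> psd (Phi c1 c2 c3 1)"
    using psd_Phi_imp_le_sigma_obj[of c1 c2 c3] unfolding mem_K_iff
    by (meson abs_ge_zero order_trans)
  then show ?thesis
    using False by simp
next
  case True
  obtain t where t: "t > 0" and min: "\<And>u. u > 0 \<Longrightarrow> sigma_obj c1 c3 t \<le> sigma_obj c1 c3 u"
    using sigma_obj_attains_min K_pos[OF True] by blast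
  have sigma: "sigma c1 c3 = sigma_obj c1 c3 t"
    using t min by (rule sigma_eqI)
  have nonneg: "sigma c1 c3 \<ge> 0"
    using True t by (simp add: sigma mem_K_iff)
  have dec: "Phi c1 (s * sigma c1 c3) c3 1 =
      (\<lambda>x y z. Rt t x y z + sigma c1 c3 / t^3 * (t^3 * F1 x y z + s * F2 x y z)^2)"
    if "s^2 = 1" for s
    using decomposition_at_min[OF t min that] by (simp add: sigma)
  \<comment> \<open>The square has the coefficient \<open>sigma c1 c3 / t^3\<close>, which is
    nonnegative because membership in \<open>K\<close> makes the minimum nonnegative.\<close>
  have "psd (Phi c1 (s * sigma c1 c3) c3 1)" if "s^2 = 1" for s
    using psd_Rt[OF t] t nonneg unfolding dec[OF that] psd_def by simp
  from this[of 1] this[of "-1"] have "psd (Phi c1 c2 c3 1)" if "\<bar>c2\<bar> \<le> sigma c1 c3"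
    using that by (auto intro: psd_Phi_between)
  then have "psd (Phi c1 c2 c3 1) \<longleftrightarrow> \<bar>c2\<bar> \<le> sigma c1 c3"
    using psd_Phi_imp_le_sigma_obj[OF _ t] sigma by auto
  moreover have "\<exists>t>0. \<exists>\<mu>. \<exists>s\<in>{1, -1}.
      Phi c1 c2 c3 1 = (\<lambda>x y z. Rt t x y z + \<mu> * (t^3 * F1 x y z + s * F2 x y z)^2)"
    if "c2 = sigma c1 c3 \<or> c2 = - sigma c1 c3"
  proof -
    from that obtain s where "s \<in> {1, -1}" "c2 = s * sigma c1 c3"
      by force
    moreover from this(1) have "s^2 = 1"
      by auto
    ultimately show ?thesis
      using dec[of s] t by blast
  qed
  ultimately show ?thesis
    using True nonneg sigma t min by auto
qed

end
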